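(* For any elements $u,v\in W$ we have $$\Phi_{(u,v)}=1+Y\Phi_u+Y\Phi_v\qquad\text{and}\qquad \Phi_{(u,v)\,\sigma}=1+XY\Phi_{uv}.$$
   Context: Let $T$ be the infinite rooted regular binary tree whose vertices are the finite words over $\{0,1\}$, with root the empty word, each word $t$ being joined by an edge to the words $0t$ and $1t$. Level $n$ of $T$ is the set of words of length $n$. Let $W=\mathrm{Aut}(T)$ be the automorphism group of $T$ (products are compositions, $(uv)(t)=u(v(t))$). For $u,v\in W$, let $(u,v)\in W$ be the automorphism fixing the root and given by $t0\mapsto u(t)0$ and $t1\mapsto v(t)1$ for every word $t$. Let $\sigma\in W$ be the involution fixing the root with $t0\mapsto t1$ and $t1\mapsto t0$ for every word $t$. For $w\in W$, every orbit of $w$ on level $n$ has length $2^m$ for some $0\le m\le n$. The orbit length generating function of $w$ is $\Phi_w=\sum_{n\ge m\ge 0}o_{m,n}(w)X^mY^n\in 1+Y\mathbb{Z}[[X,Y]]$, where $o_{m,n}(w)$ is the number of orbits of $w$ of length $2^m$ on level $n$. *)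

theory Defs
  imports "HOL-Combinatorics.Orbits" "HOL-Computational_Algebra.Formal_Power_Series"
begin

text \<open>
  Words over \<open>{0, 1}\<close> are boolean lists read from left to right, with \<open>False\<close> for the
  letter 0 and \<open>True\<close> for the letter 1.  The children of the vertex \<open>t\<close> are the words
  \<open>0t\<close> and \<open>1t\<close>; hence the two subtrees below the root are told apart by the
  \<^emph>\<open>last\<close> letter of a word.
\<close>

type_synonym word = "bool list"

definition tree_edge :: "word \<Rightarrow> word \<Rightarrow> bool" where
  "tree_edge s t \<longleftrightarrow> (\<exists>a. t = a # s \<or> s = a # t)"

definition level :: "nat \<Rightarrow> word set" where
  "level n = {t. length t = n}"

text \<open>
  Graph automorphisms of the tree.  Preservation of the root need not be demanded
  (lemma \<open>Aut_tree_root\<close>), since the root is the only vertex of degree 2.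
\<close>

definition Aut_tree :: "(word \<Rightarrow> word) set" where
  "Aut_tree = {w. bij w \<and> (\<forall>s t. tree_edge (w s) (w t) \<longleftrightarrow> tree_edge s t)}"

definition pair_aut :: "(word \<Rightarrow> word) \<Rightarrow> (word \<Rightarrow> word) \<Rightarrow> word \<Rightarrow> word" where
  "pair_aut u v s =
     (if s = [] then []
      else if last s then v (butlast s) @ [True]
      else u (butlast s) @ [False])"

definition swap_aut :: "word \<Rightarrow> word" where
  "swap_aut s = (if s = [] then [] else butlast s @ [\<not> last s])"

text \<open>
  \<open>orbit w t\<close> consists of the \<open>(w ^^ k) t\<close> with \<open>k > 0\<close>.  For \<open>w\<close> an automorphism this is the
  orbit of \<open>t\<close> under the group generated by \<open>w\<close>, as \<open>w\<close> permutes the finite levels.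
\<close>

definition num_orbits :: "(word \<Rightarrow> word) \<Rightarrow> nat \<Rightarrow> nat \<Rightarrow> nat" where
  "num_orbits w m n = card {B \<in> orbit w ` level n. card B = 2 ^ m}"

text \<open>
  The ring of power series over the integers in \<open>X\<close> and \<open>Y\<close> is taken as power series in \<open>Y\<close>
  (outer layer) whose coefficients are power series in \<open>X\<close> (inner layer).
\<close>

abbreviation X_var :: "int fps fps" where
  "X_var \<equiv> fps_const fps_X"

abbreviation Y_var :: "int fps fps" where
  "Y_var \<equiv> fps_X"

definition orbit_gf :: "(word \<Rightarrow> word) \<Rightarrow> int fps fps" where
  "orbit_gf w =
     Abs_fps (\<lambda>n. Abs_fps (\<lambda>m. if m \<le> n then int (num_orbits w m n) else 0))"

lemma pair_aut_simps [simp]: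
  "pair_aut u v [] = []"
  "pair_aut u v (t @ [False]) = u t @ [False]"
  "pair_aut u v (t @ [True]) = v t @ [True]"
  by (simp_all add: pair_aut_def)

lemma swap_aut_simps [simp]:
  "swap_aut [] = []"
  "swap_aut (t @ [False]) = t @ [True]"
  "swap_aut (t @ [True]) = t @ [False]"
  by (simp_all add: swap_aut_def)

lemma Aut_tree_root:
  assumes "w \<in> Aut_tree"
  shows "w [] = []"
proof (rule ccontr)
  assume "w [] \<noteq> []"
  then obtain a t where wr: "w [] = a # t"
    by (cases "w []") auto
  have bij: "bij w" and E: "\<And>s t. tree_edge (w s) (w t) \<longleftrightarrow> tree_edge s t"
    using assms by (auto simp: Aut_tree_def)
  have img: "w ` {s. tree_edge [] s} = {s. tree_edge (w []) s}"
  proof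
    show "{s. tree_edge (w []) s} \<subseteq> w ` {s. tree_edge [] s}"
    proof
      fix s assume s: "s \<in> {s. tree_edge (w []) s}"
      obtain r where "s = w r" using bij by (metis bij_pointE)
      with s E show "s \<in> w ` {s. tree_edge [] s}" by auto
    qed
  qed (use E in auto)
  have "card (w ` {s. tree_edge [] s}) = card {s. tree_edge [] s}"
    using bij by (intro card_image) (auto simp: bij_def inj_on_def)
  moreover have "{s. tree_edge [] s} = {[False], [True]}"
    by (auto simp: tree_edge_def)
  moreover have "{s. tree_edge (a # t) s} = {t, False # a # t, True # a # t}"
    by (auto simp: tree_edge_def)
  moreover have "card {t, False # a # t, True # a # t} = 3"
    by (auto simp: card_insert_if dest: arg_cong[where f = length])
  ultimately show False
    using img wr by simp
qed

lemma Aut_tree_comp: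
  assumes "u \<in> Aut_tree" "v \<in> Aut_tree"
  shows "u \<circ> v \<in> Aut_tree"
  using assms by (auto simp: Aut_tree_def bij_comp)

lemma tree_edge_snoc:
  "tree_edge (s @ [a]) (t @ [b]) \<longleftrightarrow> a = b \<and> tree_edge s t"
  by (auto simp: tree_edge_def Cons_eq_append_conv append_eq_Cons_conv) 

lemma tree_edge_Nil [simp]:
  "tree_edge [] (t @ [b]) \<longleftrightarrow> t = []" "tree_edge (t @ [b]) [] \<longleftrightarrow> t = []" "\<not> tree_edge [] []"
  by (auto simp: tree_edge_def Cons_eq_append_conv append_eq_Cons_conv)

lemma swap_aut_mem: "swap_aut \<in> Aut_tree"
proof -
  have inv: "swap_aut (swap_aut s) = s" for s
    by (cases s rule: rev_cases) (auto simp: swap_aut_def)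
  have "bij swap_aut"
    by (rule o_bij[of swap_aut]) (auto simp: inv)
  moreover have "tree_edge (swap_aut s) (swap_aut t) \<longleftrightarrow> tree_edge s t" for s t
    by (cases s rule: rev_cases; cases t rule: rev_cases)
      (auto simp: swap_aut_def tree_edge_snoc)
  ultimately show ?thesis by (auto simp: Aut_tree_def)
qed

lemma pair_aut_mem:
  assumes u: "u \<in> Aut_tree" and v: "v \<in> Aut_tree"
  shows "pair_aut u v \<in> Aut_tree"
proof -
  have bij: "bij u" "bij v"
    and E: "\<And>s t. tree_edge (u s) (u t) \<longleftrightarrow> tree_edge s t"
           "\<And>s t. tree_edge (v s) (v t) \<longleftrightarrow> tree_edge s t"
    using assms by (auto simp: Aut_tree_def)
  have root: "u s = [] \<longleftrightarrow> s = []" "v s = [] \<longleftrightarrow> s = []" for s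
    using Aut_tree_root[OF u] Aut_tree_root[OF v] bij by (metis bij_pointE)+
  have i1: "pair_aut u v (pair_aut (inv u) (inv v) s) = s" for s
    by (cases s rule: rev_cases)
      (use bij in \<open>auto simp: pair_aut_def bij_is_surj surj_f_inv_f\<close>)
  have i2: "pair_aut (inv u) (inv v) (pair_aut u v s) = s" for s
    by (cases s rule: rev_cases)
      (use bij in \<open>auto simp: pair_aut_def bij_is_inj inv_f_f\<close>)
  have "bij (pair_aut u v)"
    by (rule o_bij[of "pair_aut (inv u) (inv v)"]) (auto simp: i1 i2)
  moreover have "tree_edge (pair_aut u v s) (pair_aut u v t) \<longleftrightarrow> tree_edge s t" for s t
    by (cases s rule: rev_cases; cases t rule: rev_cases)
      (auto simp: pair_aut_def tree_edge_snoc E root)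
  ultimately show ?thesis by (auto simp: Aut_tree_def)
qed

end

theory Submission
  imports Defs
begin

text \<open>
  Level \<open>n + 1\<close> consists of two copies of level \<open>n\<close>, below the vertices 0 and 1.  On them
  \<open>(u, v)\<close> acts as \<open>u\<close> and as \<open>v\<close>, so its orbits are those of \<open>u\<close> together with those of \<open>v\<close>.
  The automorphism \<open>(u, v)\<sigma>\<close> exchanges the copies and its square acts on the 0-copy as \<open>uv\<close>,
  so each of its orbits meets the 0-copy in an orbit of \<open>uv\<close> and is twice as long.
\<close>

lemma finite_level: "finite (level n)"
  using finite_lists_length_eq[of "UNIV :: bool set" n] by (simp add: level_def)

lemma level_0 [simp]: "level 0 = {[]}"
  by (auto simp: level_def)

lemma card_level: "card (level n) = 2 ^ n"
  using card_lists_length_eq[of "UNIV :: bool set" n] by (simp add: level_def)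

lemma level_Suc:
  "level (Suc n) = (\<lambda>t. t @ [False]) ` level n \<union> (\<lambda>t. t @ [True]) ` level n"
proof -
  have "s \<in> (\<lambda>t. t @ [False]) ` level n \<union> (\<lambda>t. t @ [True]) ` level n"
    if "s \<in> level (Suc n)" for s
    using that by (cases s rule: rev_cases) (auto simp: level_def image_iff)
  then show ?thesis
    by (auto simp: level_def)
qed

text \<open>
  The child \<open>a # t\<close> of \<open>t\<close> goes to a neighbour of \<open>w t\<close>, which cannot be the parent of \<open>w t\<close>:
  by induction that is the image of the parent of \<open>t\<close>, and \<open>w\<close> is injective.
\<close>

lemma length_Aut_tree:
  assumes w: "w \<in> Aut_tree"
  shows "length (w s) = length s"
proof (induction s rule: length_induct)
  case (1 s)
  have inj: "inj w" and E: "\<And>s t. tree_edge (w s) (w t) \<longleftrightarrow> tree_edge s t"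
    using w by (auto simp: Aut_tree_def bij_def)
  have edge: "(\<exists>b. w (a # t) = b # w t) \<or> (\<exists>b. w t = b # w (a # t))" for a t
    using E[of t "a # t"] by (auto simp: tree_edge_def)
  show ?case
  proof (cases s)
    case Nil
    then show ?thesis using Aut_tree_root[OF w] by simp
  next
    case s: (Cons a t)
    have IH: "length (w r) = length r" if "length r \<le> length t" for r
      using 1 that s by simp
    have False if t: "w t = b # w s" for b
    proof (cases t)
      case Nil
      then show False using t Aut_tree_root[OF w] by simp
    next
      case (Cons c r)
      have "length (w t) = Suc (length (w r))" using IH[of t] IH[of r] Cons by simp
      then obtain d where "w t = d # w r" using edge[of c r] Cons by auto
      then have "w s = w r" using t by simp
      then have "s = r" using inj by (simp add: inj_eq)
      then show False using s Cons by simp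
    qed
    then obtain b where "w s = b # w t" using edge[of a t] s by auto
    then show ?thesis using IH[of t] s by simp
  qed
qed

lemma Aut_tree_level:
  assumes "w \<in> Aut_tree"
  shows "w ` level n = level n"
proof (rule card_subset_eq[OF finite_level])
  show "w ` level n \<subseteq> level n"
    using length_Aut_tree[OF assms] by (auto simp: level_def)
  have "inj w" using assms by (auto simp: Aut_tree_def bij_def)
  then show "card (w ` level n) = card (level n)"
    by (intro card_image) (auto simp: inj_on_def)
qed

lemma orbit_subset_level:
  assumes "w \<in> Aut_tree" "t \<in> level n"
  shows "orbit w t \<subseteq> level n"
proof
  fix s assume "s \<in> orbit w t"
  then show "s \<in> level n"
    by induction (use assms Aut_tree_level[of w n] in auto)
qed

text \<open>\<open>orbit\<close> collects only the positive iterates, so some positive power must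
  return to \<open>t\<close>. The iterates stay in the finite level of \<open>t\<close>, hence
  repeat, and injectivity makes the first repeated one \<open>t\<close> itself.\<close>

lemma self_in_orbit_Aut_tree:
  assumes w: "w \<in> Aut_tree"
  shows "t \<in> orbit w t"
proof -
  have "inj w" using w by (auto simp: Aut_tree_def bij_def)
  moreover have "length ((w ^^ k) t) = length t" for k
    by (induction k) (simp_all add: length_Aut_tree[OF w])
  then have "finite {y. \<exists>k. y = (w ^^ k) t}"
    by (intro finite_subset[OF _ finite_level[of "length t"]]) (auto simp: level_def)
  ultimately obtain k where "k > 0" "(w ^^ k) t = t"
    by (rule funpow_inj_finite)
  then show ?thesis unfolding orbit_altdef by force
qed

lemma num_orbits_0:
  assumes "w \<in> Aut_tree"
  shows "num_orbits w m 0 = (if m = 0 then 1 else 0)"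
proof -
  have "orbit w [] = {[]}"
    using Aut_tree_root[OF assms] by (simp add: orbit_eq_singleton_iff)
  then have "orbit w ` level 0 = {{[]}}" by simp
  moreover have "{B \<in> {{[]::bool list}}. card B = 2 ^ m} = (if m = 0 then {{[]}} else {})"
    by (cases m) auto
  ultimately show ?thesis by (simp add: num_orbits_def)
qed

text \<open>An orbit on level \<open>n\<close> lies among \<open>2 ^ n\<close> words. This makes
  \<open>orbit_gf_nth\<close> valid for all \<open>m\<close> and \<open>n\<close>, so coefficients
  can be compared without regard to the cutoff in \<open>orbit_gf\<close>.\<close>

lemma num_orbits_eq_0:
  assumes "w \<in> Aut_tree" "n < m"
  shows "num_orbits w m n = 0"
proof -
  have "card B < 2 ^ m" if B: "B \<in> orbit w ` level n" for B
  proof -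
    have "card B \<le> 2 ^ n"
      using B orbit_subset_level[OF assms(1)] card_mono[OF finite_level, of B n]
      by (auto simp: card_level)
    also have "(2::nat) ^ n < 2 ^ m" using assms(2) by simp
    finally show ?thesis .
  qed
  then have "{B \<in> orbit w ` level n. card B = 2 ^ m} = {}" by fastforce
  then show ?thesis by (simp only: num_orbits_def card.empty)
qed

lemma orbit_gf_nth:
  assumes "w \<in> Aut_tree"
  shows "fps_nth (fps_nth (orbit_gf w) n) m = int (num_orbits w m n)"
  using num_orbits_eq_0[OF assms, of n m] by (auto simp: orbit_gf_def)

lemma num_orbits_pair_aut:
  assumes "u \<in> Aut_tree" "v \<in> Aut_tree"
  shows "num_orbits (pair_aut u v) m (Suc n) = num_orbits u m n + num_orbits v m n"
proof -
  define F T where FT: "F = (\<lambda>t::word. t @ [False])" "T = (\<lambda>t::word. t @ [True])"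
  have inj: "inj F" "inj T" by (auto simp: FT inj_on_def)
  define P where "P w = {B \<in> orbit w ` level n. card B = 2 ^ m}" for w
  \<comment> \<open>\<open>F\<close> intertwines \<open>u\<close> with \<open>pair_aut u v\<close>,
    as \<open>T\<close> does \<open>v\<close>, and \<open>orbit_inverse\<close> carries orbits along
    such a map.\<close>
  have "orbit (pair_aut u v) (F t) = F ` orbit u t" for t
    by (rule orbit_inverse[symmetric]) (use assms in \<open>auto simp: FT self_in_orbit_Aut_tree\<close>)
  moreover have "orbit (pair_aut u v) (T t) = T ` orbit v t" for t
    by (rule orbit_inverse[symmetric]) (use assms in \<open>auto simp: FT self_in_orbit_Aut_tree\<close>)
  ultimately have "orbit (pair_aut u v) ` level (Suc n) =
      image F ` orbit u ` level n \<union> image T ` orbit v ` level n"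
    unfolding level_Suc FT[symmetric] by (simp add: image_Un image_image)
  moreover have "card (F ` B) = card B" "card (T ` B) = card B" for B
    using inj by (simp_all add: card_image inj_on_subset[OF _ subset_UNIV])
  ultimately have "{B \<in> orbit (pair_aut u v) ` level (Suc n). card B = 2 ^ m} =
      image F ` P u \<union> image T ` P v"
    by (auto simp: P_def)
  \<comment> \<open>Words in the two images differ in their last letter. This separates the sets
    because orbits are nonempty: \<open>F\<close> and \<open>T\<close> agree on the empty
    set.\<close>
  moreover have "image F ` P u \<inter> image T ` P v = {}"
  proof -
    have "F ` B \<noteq> T ` C" if "B \<in> P u" for B C
    proof -
      have "B \<noteq> {}" using that by (auto simp: P_def orbit_nonempty)
      then obtain b where "b \<in> B" by blast
      then have "F b \<in> F ` B" by simp
      moreover have "F b \<notin> T ` C" by (auto simp: FT)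
      ultimately show ?thesis by metis
    qed
    then show ?thesis by blast
  qed
  moreover have "finite (P w)" for w by (simp add: P_def finite_level)
  moreover have "card (image F ` A) = card A" "card (image T ` A) = card A" for A
    using inj by (auto intro!: card_image inj_onI simp: inj_image_eq_iff)
  ultimately have "card {B \<in> orbit (pair_aut u v) ` level (Suc n). card B = 2 ^ m} =
      card (P u) + card (P v)"
    by (simp add: card_Un_disjoint)
  then show ?thesis by (simp add: num_orbits_def P_def)
qed

text \<open>For an orbit \<open>B\<close> of \<open>u \<circ> v\<close> this is the orbit of (u,
  v)\<sigma> meeting the 0-copy in \<open>B\<close>: the map sends \<open>t @ [False]\<close> to
  \<open>v t @ [True]\<close>, and that to \<open>u (v t) @ [False]\<close>.\<close>

definition doubled_orbit :: "(word \<Rightarrow> word) \<Rightarrow> word set \<Rightarrow> word set" where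
  "doubled_orbit v B = (\<lambda>t. t @ [False]) ` B \<union> (\<lambda>t. v t @ [True]) ` B"

text \<open>The words ending in 0 recover the original set. Hence distinct orbits of
  \<open>u \<circ> v\<close> yield distinct orbits, and counting them commutes with
  doubling.\<close>

lemma inj_doubled_orbit: "inj (doubled_orbit v)"
proof (rule injI)
  fix A B assume eq: "doubled_orbit v A = doubled_orbit v B"
  have "t \<in> C \<longleftrightarrow> t @ [False] \<in> doubled_orbit v C" for t C
    by (auto simp: doubled_orbit_def)
  then show "A = B" using eq by blast
qed

lemma card_doubled_orbit:
  assumes "inj v" "finite B"
  shows "card (doubled_orbit v B) = 2 * card B"
proof -
  have "card ((\<lambda>t. t @ [False]) ` B) = card B" "card ((\<lambda>t. v t @ [True]) ` B) = card B"
    using assms(1) by (auto intro!: card_image simp: inj_on_def)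
  moreover have "(\<lambda>t. t @ [False]) ` B \<inter> (\<lambda>t. v t @ [True]) ` B = {}" by auto
  ultimately show ?thesis
    using assms(2) by (simp add: doubled_orbit_def card_Un_disjoint)
qed

lemma orbit_pair_swap_False:
  assumes "u \<in> Aut_tree" "v \<in> Aut_tree"
  shows "orbit (pair_aut u v \<circ> swap_aut) (t @ [False]) = doubled_orbit v (orbit (u \<circ> v) t)"
    (is "orbit ?w _ = _")
proof
  show "orbit ?w (t @ [False]) \<subseteq> doubled_orbit v (orbit (u \<circ> v) t)"
  proof
    fix s assume "s \<in> orbit ?w (t @ [False])"
    then show "s \<in> doubled_orbit v (orbit (u \<circ> v) t)"
    proof induction
      case base
      \<comment> \<open>The first iterate is the 1-copy partner of \<open>t\<close> itself, so
        \<open>t\<close> has to belong to its own orbit under \<open>u \<circ> v\<close>.\<close>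
      have "?w (t @ [False]) = v t @ [True]" by simp
      then show ?case
        unfolding doubled_orbit_def
        using self_in_orbit_Aut_tree[OF Aut_tree_comp[OF assms], of t] by blast
    next
      case (step s)
      from step.IH obtain x where x: "x \<in> orbit (u \<circ> v) t"
        and "s = x @ [False] \<or> s = v x @ [True]"
        unfolding doubled_orbit_def by blast
      then have "?w s = v x @ [True] \<or> ?w s = (u \<circ> v) x @ [False]" by auto
      then show ?case
        unfolding doubled_orbit_def using x orbit.step[OF x] by blast
    qed
  qed
next
  have w1: "?w (x @ [False]) = v x @ [True]" for x by simp
  have w2: "?w (v x @ [True]) = (u \<circ> v) x @ [False]" for x by simp
  have "x @ [False] \<in> orbit ?w (t @ [False])" if "x \<in> orbit (u \<circ> v) t" for x
    using that
  proof induction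
    case base
    \<comment> \<open>The orbit of \<open>u \<circ> v\<close> starts at
      \<open>(u \<circ> v) t\<close>, which the second iterate of \<open>?w\<close> reaches; each
      later step of \<open>u \<circ> v\<close> likewise takes two of \<open>?w\<close>.\<close>
    show ?case using orbit.step[OF orbit.base[of ?w "t @ [False]"]] by (simp only: w1 w2)
  next
    case (step x)
    show ?case using orbit.step[OF orbit.step[OF step.IH]] by (simp only: w1 w2)
  qed
  moreover from this have "v x @ [True] \<in> orbit ?w (t @ [False])" if "x \<in> orbit (u \<circ> v) t" for x
    using orbit.step[of "x @ [False]" ?w "t @ [False]"] that by (simp only: w1)
  ultimately show "doubled_orbit v (orbit (u \<circ> v) t) \<subseteq> orbit ?w (t @ [False])"
    by (auto simp: doubled_orbit_def)
qed

lemma orbits_pair_swap: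
  assumes "u \<in> Aut_tree" "v \<in> Aut_tree"
  shows "orbit (pair_aut u v \<circ> swap_aut) ` level (Suc n) =
    doubled_orbit v ` orbit (u \<circ> v) ` level n"
proof -
  let ?w = "pair_aut u v \<circ> swap_aut"
  have w: "?w \<in> Aut_tree"
    using assms by (intro Aut_tree_comp pair_aut_mem swap_aut_mem)
  \<comment> \<open>Since \<open>v\<close> permutes level \<open>n\<close>, every word of the 1-copy
    is some \<open>v t @ [True]\<close>, the image of \<open>t @ [False]\<close>. So the 1-copy
    contributes the same orbits as the 0-copy.\<close>
  have "orbit ?w (v t @ [True]) = orbit ?w (t @ [False])" for t
    using self_in_orbit_step[OF self_in_orbit_Aut_tree[OF w, of "t @ [False]"]] by simp
  then have "(\<lambda>t. orbit ?w (t @ [True])) ` v ` level n = (\<lambda>t. orbit ?w (t @ [False])) ` level n"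
    by (simp only: image_image)
  then show ?thesis
    by (simp only: level_Suc image_Un image_image Aut_tree_level[OF assms(2)]
        orbit_pair_swap_False[OF assms] Un_absorb)
qed

lemma num_orbits_pair_swap:
  assumes "u \<in> Aut_tree" "v \<in> Aut_tree"
  shows "num_orbits (pair_aut u v \<circ> swap_aut) m (Suc n) =
    (case m of 0 \<Rightarrow> 0 | Suc k \<Rightarrow> num_orbits (u \<circ> v) k n)"
proof -
  let ?O = "orbit (u \<circ> v) ` level n"
  have "inj v" using assms(2) by (auto simp: Aut_tree_def bij_def)
  moreover have "finite B" if "B \<in> ?O" for B
    using that finite_orbit[OF self_in_orbit_Aut_tree[OF Aut_tree_comp[OF assms]]] by auto
  ultimately have "card (doubled_orbit v B) = 2 * card B" if "B \<in> ?O" for B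
    using that card_doubled_orbit by blast
  then have "{C \<in> doubled_orbit v ` ?O. card C = 2 ^ m} =
      doubled_orbit v ` {B \<in> ?O. 2 * card B = 2 ^ m}"
    by auto
  then have "num_orbits (pair_aut u v \<circ> swap_aut) m (Suc n) = card {B \<in> ?O. 2 * card B = 2 ^ m}"
    by (simp only: num_orbits_def orbits_pair_swap[OF assms]
        card_image[OF inj_on_subset[OF inj_doubled_orbit subset_UNIV]])
  \<comment> \<open>For \<open>m = 0\<close> the equation \<open>2 * card B = 1\<close> has no
    solution; otherwise a factor 2 cancels.\<close>
  also have "\<dots> = (case m of 0 \<Rightarrow> 0 | Suc k \<Rightarrow> num_orbits (u \<circ> v) k n)"
    by (cases m) (simp_all add: num_orbits_def)
  finally show ?thesis .
qed

theorem proposition2p3: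
  fixes u v :: "word \<Rightarrow> word"
  assumes "u \<in> Aut_tree" and "v \<in> Aut_tree"
  shows "orbit_gf (pair_aut u v) = 1 + Y_var * orbit_gf u + Y_var * orbit_gf v
       \<and> orbit_gf (pair_aut u v \<circ> swap_aut) = 1 + X_var * Y_var * orbit_gf (u \<circ> v)"
proof
  have p: "pair_aut u v \<in> Aut_tree" using assms by (rule pair_aut_mem)
  show "orbit_gf (pair_aut u v) = 1 + Y_var * orbit_gf u + Y_var * orbit_gf v"
  proof (intro fps_ext)
    fix n m
    show "fps_nth (fps_nth (orbit_gf (pair_aut u v)) n) m =
        fps_nth (fps_nth (1 + Y_var * orbit_gf u + Y_var * orbit_gf v) n) m"
      \<comment> \<open>Level 0 carries only the root, which gives the summand 1; multiplication by
        Y shifts \<open>n\<close> by one.\<close>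
      by (cases n) (simp_all add: orbit_gf_nth p assms num_orbits_0 num_orbits_pair_aut)
  qed
  have q: "pair_aut u v \<circ> swap_aut \<in> Aut_tree" using p swap_aut_mem by (rule Aut_tree_comp)
  have uv: "u \<circ> v \<in> Aut_tree" using assms by (rule Aut_tree_comp)
  show "orbit_gf (pair_aut u v \<circ> swap_aut) = 1 + X_var * Y_var * orbit_gf (u \<circ> v)"
  proof (intro fps_ext)
    fix n m
    show "fps_nth (fps_nth (orbit_gf (pair_aut u v \<circ> swap_aut)) n) m =
        fps_nth (fps_nth (1 + X_var * Y_var * orbit_gf (u \<circ> v)) n) m"
      \<comment> \<open>The factor X acts on the inner series and shifts \<open>m\<close>, matching
        the doubled orbit lengths.\<close>
      by (cases n; cases m)
        (simp_all add: mult.assoc orbit_gf_nth q uv num_orbits_0 num_orbits_pair_swap[OF assms])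
  qed
qed

end
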